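(* For every instance of the problem (every $k\in[0,1)$, every obstacle $[o,o+L]$, and every location profile $\mathbf x=(x_1,\ldots,x_n)$), the preference profile of the agents over the set $D=\{(a,b)\in\mathbb R^2 : 0\le a<o\le o+L<b\le 1\}$ of possible edges is $2$-dimensional single-peaked.
   Context: Setting. Fix a constant $k\in[0,1)$ and an obstacle $[o,o+L]$ with $o\in(0,1)$ and $0\le L<1-o$. Agents $N=\{1,\ldots,n\}$ have locations $x_i\in[0,o)\cup(o+L,1]$; $N_1=\{i: x_i<o\}$ and $N_2=\{i: x_i>o+L\}$. An outcome is an edge $(a,b)$ with $a\in[0,o)$, $b\in(o+L,1]$. The cost of agent $i\in N_1$ is $cost(a,b,x_i)=|x_i-a|+k(b-a)+(1-b)$; the cost of agent $i\in N_2$ is $cost(a,b,x_i)=|x_i-b|+k(b-a)+a$. Agent $i$'s preference $\succeq_i$ on $D$ is: $\alpha\succeq_i\beta$ iff the cost of agent $i$ under $\alpha$ is at most the cost of agent $i$ under $\beta$. Single-peakedness. A one-dimensional axis $A$ on $D$ is a strict (total) ordering $<_A$ of the outcomes in $D$. An $m$-dimensional axis $A^m=\langle A_1,\ldots,A_m\rangle$ is a collection of $m$ distinct one-dimensional axes on $D$. A preference $\succeq_i$ is $m$-dimensional single-peaked with respect to $A^m$ if (1) there is a single most-preferred outcome (peak) $p_i\in D$, and (2) for any two outcomes $\alpha,\beta\in D$, $\alpha\succeq_i\beta$ whenever for every $t=1,\ldots,m$ either $\beta<_{A_t}\alpha<_{A_t}p_i$ or $p_i<_{A_t}\alpha<_{A_t}\beta$.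 A preference profile is $m$-dimensional single-peaked if there is an $m$-dimensional axis $A^m$ such that every agent's preference is $m$-dimensional single-peaked with respect to $A^m$. *)

theory Defs
  imports Complex_Main
begin

text \<open>
  An axis is a strict total order \<open><\<^sub>A\<close> on \<open>D\<close>, given as the set of pairs \<open>(\<alpha>, \<beta>)\<close> with
  \<open>\<alpha> <\<^sub>A \<beta>\<close>. It is required to be a subset of \<open>D \<times> D\<close>, so that distinct axes differ on \<open>D\<close>.
\<close>

definition axis_on :: "'a set \<Rightarrow> 'a rel \<Rightarrow> bool" where
  "axis_on D A \<longleftrightarrow> A \<subseteq> D \<times> D \<and> strict_linear_order_on D A"

definition multi_axis_on :: "'a set \<Rightarrow> nat \<Rightarrow> 'a rel list \<Rightarrow> bool" where
  "multi_axis_on D m As \<longleftrightarrow> length As = m \<and> distinct As \<and> (\<forall>A \<in> set As. axis_on D A)"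

text \<open>
  A preference is a relation \<open>R\<close> in which \<open>(\<alpha>, \<beta>) \<in> R\<close> means that \<open>\<alpha>\<close> is weakly preferred
  to \<open>\<beta>\<close>. In the betweenness condition below, \<open>\<alpha>\<close> may lie on different sides of the peak on
  different axes.
\<close>

definition most_preferred :: "'a set \<Rightarrow> 'a rel \<Rightarrow> 'a \<Rightarrow> bool" where
  "most_preferred D R p \<longleftrightarrow> p \<in> D \<and> (\<forall>\<beta> \<in> D. (p, \<beta>) \<in> R)"

definition single_peaked_wrt :: "'a set \<Rightarrow> 'a rel list \<Rightarrow> 'a rel \<Rightarrow> bool" where
  "single_peaked_wrt D As R \<longleftrightarrow>
     (\<exists>p. most_preferred D R p \<and> (\<forall>q. most_preferred D R q \<longrightarrow> q = p) \<and>
       (\<forall>\<alpha> \<in> D. \<forall>\<beta> \<in> D.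
          (\<forall>A \<in> set As. (\<beta>, \<alpha>) \<in> A \<and> (\<alpha>, p) \<in> A \<or> (p, \<alpha>) \<in> A \<and> (\<alpha>, \<beta>) \<in> A)
            \<longrightarrow> (\<alpha>, \<beta>) \<in> R))"

definition single_peaked_profile :: "'a set \<Rightarrow> nat \<Rightarrow> 'i set \<Rightarrow> ('i \<Rightarrow> 'a rel) \<Rightarrow> bool" where
  "single_peaked_profile D m N R \<longleftrightarrow>
     (\<exists>As. multi_axis_on D m As \<and> (\<forall>i \<in> N. single_peaked_wrt D As (R i)))"

text \<open>
  The obstacle is the interval from \<open>ob\<close> to \<open>ob + L\<close> (the letter \<open>o\<close> is reserved syntax for
  function composition).
\<close>

definition edges :: "real \<Rightarrow> real \<Rightarrow> (real \<times> real) set" where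
  "edges ob L = {(a, b). 0 \<le> a \<and> a < ob \<and> ob \<le> ob + L \<and> ob + L < b \<and> b \<le> 1}"

definition locations :: "real \<Rightarrow> real \<Rightarrow> real set" where
  "locations ob L = {0..<ob} \<union> {ob + L<..1}"

text \<open>
  The cost is meant for \<open>y \<in> locations ob L\<close>, so the second branch is the case \<open>y > ob + L\<close>.
\<close>

definition cost :: "real \<Rightarrow> real \<Rightarrow> real \<times> real \<Rightarrow> real \<Rightarrow> real" where
  "cost k ob = (\<lambda>(a, b) y.
     if y < ob then \<bar>y - a\<bar> + k * (b - a) + (1 - b)
     else \<bar>y - b\<bar> + k * (b - a) + a)"

definition preference :: "real \<Rightarrow> real \<Rightarrow> real \<Rightarrow> real \<Rightarrow> (real \<times> real) rel" where
  "preference k ob L y =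
     {(\<alpha>, \<beta>). \<alpha> \<in> edges ob L \<and> \<beta> \<in> edges ob L \<and> cost k ob \<alpha> y \<le> cost k ob \<beta> y}"

end

theory Submission
  imports Defs
begin

text \<open>
  The peak of an agent at \<open>y\<close> is \<open>(y, 1)\<close> if \<open>y\<close> is left of the obstacle and \<open>(0, y)\<close> if it is
  right of it. On both sides the cost is a sum of a function of \<open>a\<close> and a function of \<open>b\<close>, each of
  which is monotone on either side of the corresponding peak coordinate. As the two axes, take the
  lexicographic orders that compare first by \<open>a\<close> and first by \<open>b\<close>: lying between the peak and
  \<open>\<beta>\<close> on both axes implies lying weakly between them in both coordinates.
\<close>

definition fst_axis :: "(real \<times> real) set \<Rightarrow> (real \<times> real) rel" where
  "fst_axis D = {(u, v) \<in> D \<times> D. fst u < fst v \<or> fst u = fst v \<and> snd u < snd v}"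

definition snd_axis :: "(real \<times> real) set \<Rightarrow> (real \<times> real) rel" where
  "snd_axis D = {(u, v) \<in> D \<times> D. snd u < snd v \<or> snd u = snd v \<and> fst u < fst v}"

lemma axis_on_fst_axis: "axis_on D (fst_axis D)"
  unfolding axis_on_def fst_axis_def strict_linear_order_on_def
  by (auto simp: trans_def irrefl_def total_on_def)

lemma axis_on_snd_axis: "axis_on D (snd_axis D)"
  unfolding axis_on_def snd_axis_def strict_linear_order_on_def
  by (auto simp: trans_def irrefl_def total_on_def)

text \<open>Symmetric in the outer arguments, so that a peak on either side is covered by one
  condition.\<close>

definition weakly_between :: "real \<Rightarrow> real \<Rightarrow> real \<Rightarrow> bool" where
  "weakly_between u v w \<longleftrightarrow> u \<le> v \<and> v \<le> w \<or> w \<le> v \<and> v \<le> u"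

text \<open>A pair in a lexicographic axis is weakly ordered in its leading coordinate, so each axis
  contributes betweenness in one coordinate; the other coordinate only breaks ties to make the order
  total.\<close>

lemma single_peaked_wrt_lex_axes:
  assumes "most_preferred D R p"
    and "\<And>q. most_preferred D R q \<Longrightarrow> q = p"
    and "\<And>\<alpha> \<beta>. \<lbrakk>\<alpha> \<in> D; \<beta> \<in> D; weakly_between (fst \<beta>) (fst \<alpha>) (fst p);
           weakly_between (snd \<beta>) (snd \<alpha>) (snd p)\<rbrakk> \<Longrightarrow> (\<alpha>, \<beta>) \<in> R"
  shows "single_peaked_wrt D [fst_axis D, snd_axis D] R"
  unfolding single_peaked_wrt_def
proof (intro exI[of _ p] conjI ballI impI allI)
  fix \<alpha> \<beta>
  assume D: "\<alpha> \<in> D" "\<beta> \<in> D"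
    and *: "\<forall>A \<in> set [fst_axis D, snd_axis D].
      (\<beta>, \<alpha>) \<in> A \<and> (\<alpha>, p) \<in> A \<or> (p, \<alpha>) \<in> A \<and> (\<alpha>, \<beta>) \<in> A"
  have "weakly_between (fst \<beta>) (fst \<alpha>) (fst p)"
    using * by (auto simp: fst_axis_def weakly_between_def)
  moreover have "weakly_between (snd \<beta>) (snd \<alpha>) (snd p)"
    using * by (auto simp: snd_axis_def weakly_between_def)
  ultimately show "(\<alpha>, \<beta>) \<in> R"
    using assms(3) D by blast
qed (fact assms)+

text \<open>Moving from \<open>u\<close> towards \<open>y\<close> as far as \<open>v\<close>
  shortens the distance by exactly \<open>\<bar>v - u\<bar>\<close>, while a linear term of slope at
  most 1 in absolute value cannot grow by more than that.\<close>

lemma tilted_abs_mono: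
  fixes c y u v :: real
  assumes "\<bar>c\<bar> \<le> 1" and "weakly_between u v y"
  shows "\<bar>y - v\<bar> + c * v \<le> \<bar>y - u\<bar> + c * u"
proof -
  have "\<bar>c * (v - u)\<bar> \<le> \<bar>v - u\<bar>"
    using assms(1) by (simp add: abs_mult mult_left_le_one_le)
  moreover have "\<bar>y - u\<bar> = \<bar>y - v\<bar> + \<bar>v - u\<bar>"
    using assms(2) by (auto simp: weakly_between_def)
  ultimately show ?thesis
    by (simp add: algebra_simps abs_le_iff)
qed

text \<open>Gives uniqueness of the peak: with slope strictly below 1 in absolute value, leaving
  \<open>y\<close> costs more in distance than the linear term can win back.\<close>

lemma tilted_abs_strict:
  fixes c y u :: real
  assumes "\<bar>c\<bar> < 1" and "\<bar>y - u\<bar> + c * u \<le> c * y"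
  shows "u = y"
proof (rule ccontr)
  assume "u \<noteq> y"
  then have "\<bar>c\<bar> * \<bar>y - u\<bar> < 1 * \<bar>y - u\<bar>"
    using assms(1) by (intro mult_strict_right_mono) auto
  moreover have "c * (y - u) \<le> \<bar>c\<bar> * \<bar>y - u\<bar>"
    by (metis abs_ge_self abs_mult)
  ultimately show False
    using assms(2) by (simp add: algebra_simps)
qed

text \<open>Separates the two coordinates: a tilted distance of slope \<open>- k\<close> in
  \<open>a\<close>, and a term in \<open>b\<close> that decreases when \<open>k < 1\<close>, which
  puts the peak at \<open>b = 1\<close>.\<close>

lemma cost_left:
  "y < ob \<Longrightarrow> cost k ob \<alpha> y = (\<bar>y - fst \<alpha>\<bar> + (- k) * fst \<alpha>) + (1 - (1 - k) * snd \<alpha>)"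
  by (simp add: cost_def split_beta algebra_simps)

lemma cost_right:
  "\<not> y < ob \<Longrightarrow> cost k ob \<alpha> y = (\<bar>y - snd \<alpha>\<bar> + k * snd \<alpha>) + (1 - k) * fst \<alpha>"
  by (simp add: cost_def split_beta algebra_simps)

lemma single_peaked_left:
  assumes k: "0 \<le> k" "k < 1" and L: "0 \<le> L" "L < 1 - ob" and y: "0 \<le> y" "y < ob"
  shows "single_peaked_wrt (edges ob L) [fst_axis (edges ob L), snd_axis (edges ob L)]
    (preference k ob L y)"
proof (rule single_peaked_wrt_lex_axes[where p = "(y, 1)"])
  have mono: "cost k ob \<alpha> y \<le> cost k ob \<beta> y"
    if "weakly_between (fst \<beta>) (fst \<alpha>) y" "snd \<beta> \<le> snd \<alpha>" for \<alpha> \<beta>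
  proof -
    have "(1 - k) * snd \<beta> \<le> (1 - k) * snd \<alpha>"
      using that k by (intro mult_left_mono) auto
    with tilted_abs_mono[of "- k", OF _ that(1)] k show ?thesis
      unfolding cost_left[OF y(2)] by linarith
  qed
  have peak: "(y, 1) \<in> edges ob L"
    using L y by (simp add: edges_def)
  show "most_preferred (edges ob L) (preference k ob L y) (y, 1)"
    unfolding most_preferred_def
  proof (intro conjI ballI)
    fix \<beta>
    assume \<beta>: "\<beta> \<in> edges ob L"
    then have "cost k ob (y, 1) y \<le> cost k ob \<beta> y"
      by (intro mono) (auto simp: edges_def weakly_between_def)
    then show "((y, 1), \<beta>) \<in> preference k ob L y"
      using peak \<beta> by (simp add: preference_def)
  qed (fact peak)
  show "q = (y, 1)" if q: "most_preferred (edges ob L) (preference k ob L y) q" for q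
  proof -
    have le: "cost k ob q y \<le> cost k ob (y, 1) y" and b: "snd q \<le> 1"
      using q peak by (auto simp: most_preferred_def preference_def edges_def)
    \<comment> \<open>The \<open>b\<close>-term of \<open>q\<close> is at least that of the peak, so
      \<open>le\<close> forces the \<open>a\<close>-term of \<open>q\<close> to be no larger than
      the peak's.\<close>
    have "(1 - k) * snd q \<le> (1 - k) * 1"
      using b k by (intro mult_left_mono) auto
    then have "\<bar>y - fst q\<bar> + (- k) * fst q \<le> (- k) * y"
      using le unfolding cost_left[OF y(2)] by simp
    then have "fst q = y"
      using k by (intro tilted_abs_strict[of "- k"]) auto
    \<comment> \<open>Once \<open>fst q = y\<close>, the \<open>a\<close>-terms in \<open>le\<close>
      cancel and the comparison of the \<open>b\<close>-terms remains.\<close>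
    moreover from this have "(1 - k) * 1 \<le> (1 - k) * snd q"
      using le by (simp add: cost_left[OF y(2)])
    then have "snd q = 1"
      using b k by simp
    ultimately show ?thesis
      by (simp add: prod_eq_iff)
  qed
  show "(\<alpha>, \<beta>) \<in> preference k ob L y"
    if "\<alpha> \<in> edges ob L" "\<beta> \<in> edges ob L"
      "weakly_between (fst \<beta>) (fst \<alpha>) (fst (y, 1))" "weakly_between (snd \<beta>) (snd \<alpha>) (snd (y, 1))"
    for \<alpha> \<beta>
  proof -
    \<comment> \<open>The peak coordinate 1 is the upper bound of \<open>b\<close> on the edges, so
      betweenness here is one-sided.\<close>
    have "snd \<beta> \<le> snd \<alpha>"
      using that by (auto simp: edges_def weakly_between_def)
    then have "cost k ob \<alpha> y \<le> cost k ob \<beta> y"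
      using that by (intro mono) auto
    then show ?thesis
      using that by (simp add: preference_def)
  qed
qed

text \<open>Mirror image of the left case: the tilted distance is now in \<open>b\<close>, and the
  term in \<open>a\<close> increases, so its optimum is the left end 0.\<close>

lemma single_peaked_right:
  assumes k: "0 \<le> k" "k < 1" and ob: "0 < ob" and L: "0 \<le> L" and y: "ob + L < y" "y \<le> 1"
  shows "single_peaked_wrt (edges ob L) [fst_axis (edges ob L), snd_axis (edges ob L)]
    (preference k ob L y)"
proof (rule single_peaked_wrt_lex_axes[where p = "(0, y)"])
  have y': "\<not> y < ob"
    using L y by simp
  have mono: "cost k ob \<alpha> y \<le> cost k ob \<beta> y"
    if "weakly_between (snd \<beta>) (snd \<alpha>) y" "fst \<alpha> \<le> fst \<beta>" for \<alpha> \<beta>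
  proof -
    have "(1 - k) * fst \<alpha> \<le> (1 - k) * fst \<beta>"
      using that k by (intro mult_left_mono) auto
    with tilted_abs_mono[of k, OF _ that(1)] k show ?thesis
      unfolding cost_right[OF y'] by linarith
  qed
  have peak: "(0, y) \<in> edges ob L"
    using ob L y by (simp add: edges_def)
  show "most_preferred (edges ob L) (preference k ob L y) (0, y)"
    unfolding most_preferred_def
  proof (intro conjI ballI)
    fix \<beta>
    assume \<beta>: "\<beta> \<in> edges ob L"
    then have "cost k ob (0, y) y \<le> cost k ob \<beta> y"
      by (intro mono) (auto simp: edges_def weakly_between_def)
    then show "((0, y), \<beta>) \<in> preference k ob L y"
      using peak \<beta> by (simp add: preference_def)
  qed (fact peak)
  show "q = (0, y)" if q: "most_preferred (edges ob L) (preference k ob L y) q" for q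
  proof -
    have le: "cost k ob q y \<le> cost k ob (0, y) y" and a: "0 \<le> fst q"
      using q peak by (auto simp: most_preferred_def preference_def edges_def)
    have "0 \<le> (1 - k) * fst q"
      using a k by simp
    then have "snd q = y"
      using le k by (intro tilted_abs_strict[of k]) (auto simp: cost_right[OF y'])
    moreover from this have "(1 - k) * fst q \<le> 0"
      using le by (simp add: cost_right[OF y'])
    then have "fst q = 0"
      using a k by (simp add: mult_le_0_iff)
    ultimately show ?thesis
      by (simp add: prod_eq_iff)
  qed
  show "(\<alpha>, \<beta>) \<in> preference k ob L y"
    if "\<alpha> \<in> edges ob L" "\<beta> \<in> edges ob L"
      "weakly_between (fst \<beta>) (fst \<alpha>) (fst (0, y))" "weakly_between (snd \<beta>) (snd \<alpha>) (snd (0, y))"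
    for \<alpha> \<beta>
  proof -
    have "fst \<alpha> \<le> fst \<beta>"
      using that by (auto simp: edges_def weakly_between_def)
    then have "cost k ob \<alpha> y \<le> cost k ob \<beta> y"
      using that by (intro mono) auto
    then show ?thesis
      using that by (simp add: preference_def)
  qed
qed

lemma fst_axis_neq_snd_axis:
  assumes "0 < ob" "0 \<le> L" "L < 1 - ob"
  shows "fst_axis (edges ob L) \<noteq> snd_axis (edges ob L)"
proof -
  \<comment> \<open>\<open>?u\<close> has the smaller \<open>a\<close> but the larger
    \<open>b\<close>, so the two axes order this pair oppositely; halving and averaging keep
    \<open>?v\<close> inside the open ends of the ranges.\<close>
  let ?u = "(0, 1) :: real \<times> real" and ?v = "(ob / 2, (ob + L + 1) / 2)"
  have "(?u, ?v) \<in> fst_axis (edges ob L)" "(?u, ?v) \<notin> snd_axis (edges ob L)"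
    using assms by (auto simp: fst_axis_def snd_axis_def edges_def)
  then show ?thesis
    by blast
qed

theorem theorem1:
  fixes k ob L :: real and n :: nat and x :: "nat \<Rightarrow> real"
  assumes "0 \<le> k" and "k < 1"
    and "0 < ob" and "ob < 1"
    and "0 \<le> L" and "L < 1 - ob"
    and "\<And>i. i \<in> {1..n} \<Longrightarrow> x i \<in> locations ob L"
  shows "single_peaked_profile (edges ob L) 2 {1..n} (\<lambda>i. preference k ob L (x i))"
  unfolding single_peaked_profile_def
proof (intro exI conjI ballI)
  show "multi_axis_on (edges ob L) 2 [fst_axis (edges ob L), snd_axis (edges ob L)]"
    using fst_axis_neq_snd_axis[OF assms(3,5,6)]
    by (simp add: multi_axis_on_def axis_on_fst_axis axis_on_snd_axis)
  fix i
  assume "i \<in> {1..n}"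
  then have "x i \<in> locations ob L"
    by (rule assms(7))
  then show "single_peaked_wrt (edges ob L) [fst_axis (edges ob L), snd_axis (edges ob L)]
      (preference k ob L (x i))"
    unfolding locations_def
    using single_peaked_left[OF assms(1,2,5,6)] single_peaked_right[OF assms(1,2,3,5)] by auto
qed

end
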